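(* Let $R$ be an associative ring with unity and let $n \geq 2$ be an integer. Then $R$ is inner McCoy if and only if the ring $DUT_n(R)$ is inner McCoy.
   Context: All rings are associative with unity. $DUT_n(R)$ denotes the ring of all $n \times n$ upper triangular matrices with entries in $R$ whose diagonal entries are all equal. For a ring $A$, $A[x]$ denotes the polynomial ring in an indeterminate $x$ commuting with $A$. A ring $A$ is inner McCoy if for every pair $f(x), g(x) \in A[x]\setminus\{0\}$ with $f(x)g(x)f(x) = 0$ there exists $r \in A\setminus\{0\}$ such that $f(x)\, r\, f(x) = 0$. *)

theory Defs
  imports "HOL-Algebra.UnivPoly" "Jordan_Normal_Form.Matrix"
begin

text \<open>
  Rings are HOL-Algebra rings: associative, with unity, not necessarily commutative.
  The polynomial ring \<open>UP A\<close> is the usual one in an indeterminate commuting with the coefficients,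
  also for noncommutative \<open>A\<close>; \<open>monom (UP A) r 0\<close> is \<open>r\<close> viewed as a constant polynomial.
\<close>

definition inner_McCoy :: "('a, 'm) ring_scheme \<Rightarrow> bool" where
  "inner_McCoy A \<longleftrightarrow>
    (\<forall>f \<in> carrier (UP A) - {\<zero>\<^bsub>UP A\<^esub>}. \<forall>g \<in> carrier (UP A) - {\<zero>\<^bsub>UP A\<^esub>}.
      f \<otimes>\<^bsub>UP A\<^esub> g \<otimes>\<^bsub>UP A\<^esub> f = \<zero>\<^bsub>UP A\<^esub> \<longrightarrow>
      (\<exists>r \<in> carrier A - {\<zero>\<^bsub>A\<^esub>}.
        f \<otimes>\<^bsub>UP A\<^esub> up_ring.monom (UP A) r 0 \<otimes>\<^bsub>UP A\<^esub> f = \<zero>\<^bsub>UP A\<^esub>))"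

text \<open>
  Matrix rows and columns are indexed by \<open>0, \<dots>, n - 1\<close>. The library's matrix ring needs a type
  class on the entries, so the operations are written out for entries from an arbitrary ring
  \<open>R\<close>; only the type of matrices is reused.
\<close>

definition DUT :: "nat \<Rightarrow> ('a, 'm) ring_scheme \<Rightarrow> 'a mat ring" where
  "DUT n R = \<lparr>
    carrier = {A \<in> carrier_mat n n.
      (\<forall>i<n. \<forall>j<n. A $$ (i, j) \<in> carrier R) \<and>
      (\<forall>i<n. \<forall>j<i. A $$ (i, j) = \<zero>\<^bsub>R\<^esub>) \<and>
      (\<forall>i<n. \<forall>j<n. A $$ (i, i) = A $$ (j, j))},
    monoid.mult = (\<lambda>A B. mat n n (\<lambda>(i, j). \<Oplus>\<^bsub>R\<^esub>k \<in> {..<n}. A $$ (i, k) \<otimes>\<^bsub>R\<^esub> B $$ (k, j))),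
    one = mat n n (\<lambda>(i, j). if i = j then \<one>\<^bsub>R\<^esub> else \<zero>\<^bsub>R\<^esub>),
    zero = mat n n (\<lambda>(i, j). \<zero>\<^bsub>R\<^esub>),
    add = (\<lambda>A B. mat n n (\<lambda>(i, j). A $$ (i, j) \<oplus>\<^bsub>R\<^esub> B $$ (i, j)))\<rparr>"

lemma (in ring) DUT_ring: "ring (DUT n R)"
proof -
  let ?D = "DUT n R"
  note D = DUT_def
  have carr_iff: "A \<in> carrier ?D \<longleftrightarrow> A \<in> carrier_mat n n \<and>
      (\<forall>i<n. \<forall>j<n. A $$ (i, j) \<in> carrier R) \<and>
      (\<forall>i<n. \<forall>j<i. A $$ (i, j) = \<zero>) \<and>
      (\<forall>i<n. \<forall>j<n. A $$ (i, i) = A $$ (j, j))" for A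
    unfolding D partial_object.simps mem_Collect_eq by (rule refl)
  have carrI: "A \<in> carrier ?D" if "A \<in> carrier_mat n n"
    "\<And>i j. i < n \<Longrightarrow> j < n \<Longrightarrow> A $$ (i, j) \<in> carrier R"
    "\<And>i j. i < n \<Longrightarrow> j < i \<Longrightarrow> A $$ (i, j) = \<zero>"
    "\<And>i j. i < n \<Longrightarrow> j < n \<Longrightarrow> A $$ (i, i) = A $$ (j, j)" for A
    using that unfolding carr_iff by blast
  have ent [simp]: "A $$ (i, j) \<in> carrier R" if "A \<in> carrier ?D" "i < n" "j < n" for A i j
    using that unfolding carr_iff by blast
  have low: "A $$ (i, j) = \<zero>" if "A \<in> carrier ?D" "i < n" "j < i" for A i j
    using that unfolding carr_iff by blast
  have diag: "A $$ (i, i) = A $$ (j, j)" if "A \<in> carrier ?D" "i < n" "j < n" for A i j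
    using that unfolding carr_iff by blast
  have mult: "(A \<otimes>\<^bsub>?D\<^esub> B) $$ (i, j) = (\<Oplus>k \<in> {..<n}. A $$ (i, k) \<otimes> B $$ (k, j))"
    if "i < n" "j < n" for A B i j
    using that unfolding D by simp
  have add [simp]: "(A \<oplus>\<^bsub>?D\<^esub> B) $$ (i, j) = A $$ (i, j) \<oplus> B $$ (i, j)"
    if "i < n" "j < n" for A B i j
    using that unfolding D by simp
  have one [simp]: "\<one>\<^bsub>?D\<^esub> $$ (i, j) = (if i = j then \<one> else \<zero>)" if "i < n" "j < n" for i j
    using that unfolding D by simp
  have zero [simp]: "\<zero>\<^bsub>?D\<^esub> $$ (i, j) = \<zero>" if "i < n" "j < n" for i j
    using that unfolding D by simp
  have opmat [simp]: "A \<otimes>\<^bsub>?D\<^esub> B \<in> carrier_mat n n" "A \<oplus>\<^bsub>?D\<^esub> B \<in> carrier_mat n n"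
    "\<one>\<^bsub>?D\<^esub> \<in> carrier_mat n n" "\<zero>\<^bsub>?D\<^esub> \<in> carrier_mat n n" for A B
    unfolding D by simp_all
  have eqI: "A = B" if "A \<in> carrier_mat n n" "B \<in> carrier_mat n n"
    "\<And>i j. i < n \<Longrightarrow> j < n \<Longrightarrow> A $$ (i, j) = B $$ (i, j)" for A B :: "'a mat"
    using that by (intro eq_matI) auto
  have cm: "A \<in> carrier_mat n n" if "A \<in> carrier ?D" for A
    using that unfolding carr_iff by blast

  have mult_closed: "A \<otimes>\<^bsub>?D\<^esub> B \<in> carrier ?D" if A: "A \<in> carrier ?D" and B: "B \<in> carrier ?D" for A B
  proof (rule carrI)
    show "(A \<otimes>\<^bsub>?D\<^esub> B) $$ (i, j) \<in> carrier R" if "i < n" "j < n" for i j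
      using that A B by (auto simp: mult intro!: finsum_closed)
    have "(\<Oplus>k \<in> {..<n}. A $$ (i, k) \<otimes> B $$ (k, j)) = \<zero>" if "i < n" "j < i" for i j
    proof (rule add.finprod_one_eqI)
      fix k assume "k \<in> {..<n}"
      then show "A $$ (i, k) \<otimes> B $$ (k, j) = \<zero>"
        using that A B low[of A i k] low[of B k j] by (cases "k < i") auto
    qed
    then show "(A \<otimes>\<^bsub>?D\<^esub> B) $$ (i, j) = \<zero>" if "i < n" "j < i" for i j
      using that by (simp add: mult)
    have d: "(A \<otimes>\<^bsub>?D\<^esub> B) $$ (i, i) = A $$ (i, i) \<otimes> B $$ (i, i)" if i: "i < n" for i
    proof -
      have "(\<Oplus>k \<in> {..<n}. A $$ (i, k) \<otimes> B $$ (k, i)) =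
            (\<Oplus>k \<in> {..<n}. if i = k then A $$ (k, k) \<otimes> B $$ (k, k) else \<zero>)"
      proof (rule finsum_cong')
        fix k assume "k \<in> {..<n}"
        then show "A $$ (i, k) \<otimes> B $$ (k, i) = (if i = k then A $$ (k, k) \<otimes> B $$ (k, k) else \<zero>)"
          using i A B low[of A i k] low[of B k i] by (cases k i rule: linorder_cases) auto
      qed (use A B in auto)
      also have "\<dots> = A $$ (i, i) \<otimes> B $$ (i, i)"
        using i A B by (intro add.finprod_singleton) auto
      finally show ?thesis using i by (simp add: mult)
    qed
    show "(A \<otimes>\<^bsub>?D\<^esub> B) $$ (i, i) = (A \<otimes>\<^bsub>?D\<^esub> B) $$ (j, j)" if "i < n" "j < n" for i j
      using that A B diag[of A i j] diag[of B i j] by (simp add: d)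
  qed simp
  have assoc: "A \<otimes>\<^bsub>?D\<^esub> B \<otimes>\<^bsub>?D\<^esub> C = A \<otimes>\<^bsub>?D\<^esub> (B \<otimes>\<^bsub>?D\<^esub> C)"
    if A: "A \<in> carrier ?D" and B: "B \<in> carrier ?D" and C: "C \<in> carrier ?D" for A B C
  proof (rule eqI)
    fix i j assume ij: "i < n" "j < n"
    have Aij: "A $$ (i, l) \<in> carrier R" if "l < n" for l using A ij that by simp
    have Bij: "B $$ (l, k) \<in> carrier R" if "l < n" "k < n" for l k using B that by simp
    have Cij: "C $$ (k, j) \<in> carrier R" if "k < n" for k using C ij that by simp
    have "(A \<otimes>\<^bsub>?D\<^esub> B \<otimes>\<^bsub>?D\<^esub> C) $$ (i, j) =
        (\<Oplus>k \<in> {..<n}. \<Oplus>l \<in> {..<n}. A $$ (i, l) \<otimes> (B $$ (l, k) \<otimes> C $$ (k, j)))"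
      unfolding mult[OF ij]
    proof (rule finsum_cong')
      fix k assume "k \<in> {..<n}"
      then have k: "k < n" by simp
      have "(A \<otimes>\<^bsub>?D\<^esub> B) $$ (i, k) \<otimes> C $$ (k, j) =
          (\<Oplus>l \<in> {..<n}. A $$ (i, l) \<otimes> B $$ (l, k) \<otimes> C $$ (k, j))"
        unfolding mult[OF ij(1) k] by (rule finsum_ldistr) (use Aij Bij Cij k in auto)
      also have "\<dots> = (\<Oplus>l \<in> {..<n}. A $$ (i, l) \<otimes> (B $$ (l, k) \<otimes> C $$ (k, j)))"
        by (rule finsum_cong') (use Aij Bij Cij k in \<open>auto simp: m_assoc\<close>)
      finally show "(A \<otimes>\<^bsub>?D\<^esub> B) $$ (i, k) \<otimes> C $$ (k, j) = \<dots>" .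
    qed (use Aij Bij Cij in \<open>auto intro!: finsum_closed\<close>)
    also have "\<dots> = (\<Oplus>l \<in> {..<n}. \<Oplus>k \<in> {..<n}. A $$ (i, l) \<otimes> (B $$ (l, k) \<otimes> C $$ (k, j)))"
      by (rule finsum_finsum_swap) (use Aij Bij Cij in auto)
    also have "\<dots> = (A \<otimes>\<^bsub>?D\<^esub> (B \<otimes>\<^bsub>?D\<^esub> C)) $$ (i, j)"
      unfolding mult[OF ij]
    proof (rule finsum_cong')
      fix l assume "l \<in> {..<n}"
      then have l: "l < n" by simp
      show "(\<Oplus>k \<in> {..<n}. A $$ (i, l) \<otimes> (B $$ (l, k) \<otimes> C $$ (k, j))) =
          A $$ (i, l) \<otimes> (B \<otimes>\<^bsub>?D\<^esub> C) $$ (l, j)"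
        unfolding mult[OF l ij(2)] by (rule finsum_rdistr [symmetric]) (use Aij Bij Cij l in auto)
    qed (use mult_closed[OF B C] Aij ij in auto)
    finally show "(A \<otimes>\<^bsub>?D\<^esub> B \<otimes>\<^bsub>?D\<^esub> C) $$ (i, j) = (A \<otimes>\<^bsub>?D\<^esub> (B \<otimes>\<^bsub>?D\<^esub> C)) $$ (i, j)" .
  qed simp_all
  have one_closed: "\<one>\<^bsub>?D\<^esub> \<in> carrier ?D"
    by (rule carrI) auto
  have l_one: "\<one>\<^bsub>?D\<^esub> \<otimes>\<^bsub>?D\<^esub> A = A" if A: "A \<in> carrier ?D" for A
  proof (rule eqI)
    fix i j assume ij: "i < n" "j < n"
    have "(\<one>\<^bsub>?D\<^esub> \<otimes>\<^bsub>?D\<^esub> A) $$ (i, j) = (\<Oplus>k \<in> {..<n}. if i = k then A $$ (k, j) else \<zero>)"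
      unfolding mult[OF ij] by (rule finsum_cong') (use ij A in auto)
    also have "\<dots> = A $$ (i, j)"
      using ij A by (intro add.finprod_singleton) auto
    finally show "(\<one>\<^bsub>?D\<^esub> \<otimes>\<^bsub>?D\<^esub> A) $$ (i, j) = A $$ (i, j)" .
  qed (simp_all add: A cm)
  have r_one: "A \<otimes>\<^bsub>?D\<^esub> \<one>\<^bsub>?D\<^esub> = A" if A: "A \<in> carrier ?D" for A
  proof (rule eqI)
    fix i j assume ij: "i < n" "j < n"
    have "(A \<otimes>\<^bsub>?D\<^esub> \<one>\<^bsub>?D\<^esub>) $$ (i, j) = (\<Oplus>k \<in> {..<n}. if j = k then A $$ (i, k) else \<zero>)"
      unfolding mult[OF ij] by (rule finsum_cong') (use ij A in auto)
    also have "\<dots> = A $$ (i, j)"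
      using ij A by (intro add.finprod_singleton) auto
    finally show "(A \<otimes>\<^bsub>?D\<^esub> \<one>\<^bsub>?D\<^esub>) $$ (i, j) = A $$ (i, j)" .
  qed (simp_all add: A cm)
  have add_closed: "A \<oplus>\<^bsub>?D\<^esub> B \<in> carrier ?D" if A: "A \<in> carrier ?D" and B: "B \<in> carrier ?D" for A B
  proof (rule carrI)
    show "(A \<oplus>\<^bsub>?D\<^esub> B) $$ (i, i) = (A \<oplus>\<^bsub>?D\<^esub> B) $$ (j, j)" if "i < n" "j < n" for i j
      using that A B diag[of A i j] diag[of B i j] by simp
  qed (use A B in \<open>simp_all add: low\<close>)
  have zero_closed: "\<zero>\<^bsub>?D\<^esub> \<in> carrier ?D"
    by (rule carrI) auto
  have inverse: "\<exists>B \<in> carrier ?D. B \<oplus>\<^bsub>?D\<^esub> A = \<zero>\<^bsub>?D\<^esub>" if A: "A \<in> carrier ?D" for A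
  proof (rule bexI)
    let ?B = "mat n n (\<lambda>(i, j). \<ominus> (A $$ (i, j)))"
    show "?B \<oplus>\<^bsub>?D\<^esub> A = \<zero>\<^bsub>?D\<^esub>"
      by (rule eqI) (use A in \<open>auto simp: l_neg\<close>)
    show "?B \<in> carrier ?D"
    proof (rule carrI)
      show "?B $$ (i, i) = ?B $$ (j, j)" if "i < n" "j < n" for i j
        using that A diag[of A i j] by simp
    qed (use A in \<open>simp_all add: low\<close>)
  qed
  show ?thesis
  proof (rule ringI)
    show "abelian_group ?D"
    proof (rule abelian_groupI)
      show "A \<oplus>\<^bsub>?D\<^esub> B \<oplus>\<^bsub>?D\<^esub> C = A \<oplus>\<^bsub>?D\<^esub> (B \<oplus>\<^bsub>?D\<^esub> C)"
        if "A \<in> carrier ?D" "B \<in> carrier ?D" "C \<in> carrier ?D" for A B C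
        by (rule eqI) (use that in \<open>auto simp: a_assoc\<close>)
      show "A \<oplus>\<^bsub>?D\<^esub> B = B \<oplus>\<^bsub>?D\<^esub> A" if "A \<in> carrier ?D" "B \<in> carrier ?D" for A B
        by (rule eqI) (use that in \<open>auto simp: a_comm\<close>)
      show "\<zero>\<^bsub>?D\<^esub> \<oplus>\<^bsub>?D\<^esub> A = A" if "A \<in> carrier ?D" for A
        by (rule eqI) (use that in \<open>simp_all add: cm\<close>)
    qed (fact add_closed zero_closed inverse)+
    show "monoid ?D"
      by (rule monoidI) (fact mult_closed one_closed assoc l_one r_one)+
    show "(A \<oplus>\<^bsub>?D\<^esub> B) \<otimes>\<^bsub>?D\<^esub> C = A \<otimes>\<^bsub>?D\<^esub> C \<oplus>\<^bsub>?D\<^esub> B \<otimes>\<^bsub>?D\<^esub> C"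
      if "A \<in> carrier ?D" "B \<in> carrier ?D" "C \<in> carrier ?D" for A B C
    proof (rule eqI)
      fix i j assume ij: "i < n" "j < n"
      have "(\<Oplus>k \<in> {..<n}. (A \<oplus>\<^bsub>?D\<^esub> B) $$ (i, k) \<otimes> C $$ (k, j)) =
          (\<Oplus>k \<in> {..<n}. A $$ (i, k) \<otimes> C $$ (k, j) \<oplus> B $$ (i, k) \<otimes> C $$ (k, j))"
        by (rule finsum_cong') (use ij that in \<open>auto simp: l_distr\<close>)
      also have "\<dots> = (\<Oplus>k \<in> {..<n}. A $$ (i, k) \<otimes> C $$ (k, j)) \<oplus> (\<Oplus>k \<in> {..<n}. B $$ (i, k) \<otimes> C $$ (k, j))"
        by (rule finsum_addf) (use ij that in auto)
      finally show "((A \<oplus>\<^bsub>?D\<^esub> B) \<otimes>\<^bsub>?D\<^esub> C) $$ (i, j) = (A \<otimes>\<^bsub>?D\<^esub> C \<oplus>\<^bsub>?D\<^esub> B \<otimes>\<^bsub>?D\<^esub> C) $$ (i, j)"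
        using ij by (simp add: mult)
    qed simp_all
    show "C \<otimes>\<^bsub>?D\<^esub> (A \<oplus>\<^bsub>?D\<^esub> B) = C \<otimes>\<^bsub>?D\<^esub> A \<oplus>\<^bsub>?D\<^esub> C \<otimes>\<^bsub>?D\<^esub> B"
      if "A \<in> carrier ?D" "B \<in> carrier ?D" "C \<in> carrier ?D" for A B C
    proof (rule eqI)
      fix i j assume ij: "i < n" "j < n"
      have "(\<Oplus>k \<in> {..<n}. C $$ (i, k) \<otimes> (A \<oplus>\<^bsub>?D\<^esub> B) $$ (k, j)) =
          (\<Oplus>k \<in> {..<n}. C $$ (i, k) \<otimes> A $$ (k, j) \<oplus> C $$ (i, k) \<otimes> B $$ (k, j))"
        by (rule finsum_cong') (use ij that in \<open>auto simp: r_distr\<close>)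
      also have "\<dots> = (\<Oplus>k \<in> {..<n}. C $$ (i, k) \<otimes> A $$ (k, j)) \<oplus> (\<Oplus>k \<in> {..<n}. C $$ (i, k) \<otimes> B $$ (k, j))"
        by (rule finsum_addf) (use ij that in auto)
      finally show "(C \<otimes>\<^bsub>?D\<^esub> (A \<oplus>\<^bsub>?D\<^esub> B)) $$ (i, j) = (C \<otimes>\<^bsub>?D\<^esub> A \<oplus>\<^bsub>?D\<^esub> C \<otimes>\<^bsub>?D\<^esub> B) $$ (i, j)"
        using ij by (simp add: mult)
    qed simp_all
  qed
qed

end

theory Submission
  imports Defs
begin

text \<open>
  A polynomial with coefficients in \<open>DUT n R\<close> is the same thing as an upper triangular matrix of
  polynomials over \<open>R\<close> with constant diagonal: its entries are obtained coefficientwise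
  (\<open>entry\<close>), and they multiply by the usual row-by-column rule (\<open>entry_mult\<close>). Everything then
  happens with triangular matrices over the ring \<open>R[x]\<close>.

  Suppose that \<open>R\<close> is inner McCoy and \<open>F G F = 0\<close> with \<open>F\<close>, \<open>G\<close> nonzero; let \<open>f\<close> be the common
  diagonal entry of \<open>F\<close>. The outermost nonzero entry of \<open>G\<close>, namely the first one in its last
  nonzero row, at position \<open>(i, j)\<close> say, meets only the diagonal of the triangular matrix \<open>F\<close> in
  the product: \<open>(F G F)\<^sub>i\<^sub>j = f G\<^sub>i\<^sub>j f\<close> (\<open>entry_sandwich_extremal\<close>). So \<open>f\<close> is
  annihilated from the inside by a nonzero polynomial, and, unless \<open>f = 0\<close> where any nonzero
  \<open>r\<close> serves, the hypothesis on \<open>R\<close> gives \<open>r \<noteq> 0\<close> with \<open>f r f = 0\<close>. The matrix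
  with \<open>r\<close> in the upper right corner and zeros elsewhere does not see the off-diagonal part of \<open>F\<close>
  at all: sandwiching it by \<open>F\<close> puts \<open>f r f = 0\<close> in the corner (\<open>entry_sandwich_corner\<close>).

  Conversely, \<open>f g f = 0\<close> over \<open>R[x]\<close> gives the same relation between the scalar matrices with
  \<open>f\<close> and \<open>g\<close> on the diagonal. If \<open>C \<noteq> 0\<close> is an inner annihilator of the scalar matrix of \<open>f\<close>,
  then \<open>f C\<^sub>i\<^sub>j f = 0\<close> for all \<open>i\<close>, \<open>j\<close> (\<open>entry_sandwich_scalar\<close>), and any nonzero entry of
  \<open>C\<close> is the required element of \<open>R\<close>.
\<close>

section \<open>Entries in the matrix ring\<close>

lemma (in ring) finsum_eq_single_term:
  assumes "finite S" "k \<in> S" "f k \<in> carrier R" "\<And>i. i \<in> S \<Longrightarrow> i \<noteq> k \<Longrightarrow> f i = \<zero>"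
  shows "finsum R f S = f k"
proof -
  have "finsum R f S = finsum R f {k}"
  proof (rule add.finprod_mono_neutral_cong_right)
    show "f \<in> S \<rightarrow> carrier R"
      using assms(3,4) by (metis Pi_I zero_closed)
  qed (use assms in auto)
  then show ?thesis
    using assms(3) by simp
qed

lemma DUT_carrier_iff:
  "A \<in> carrier (DUT n R) \<longleftrightarrow> A \<in> carrier_mat n n \<and>
    (\<forall>i<n. \<forall>j<n. A $$ (i, j) \<in> carrier R) \<and>
    (\<forall>i<n. \<forall>j<i. A $$ (i, j) = \<zero>\<^bsub>R\<^esub>) \<and>
    (\<forall>i<n. \<forall>j<n. A $$ (i, i) = A $$ (j, j))"
  unfolding DUT_def partial_object.simps mem_Collect_eq by (rule refl)

lemma DUT_entry_closed:
  "A \<in> carrier (DUT n R) \<Longrightarrow> i < n \<Longrightarrow> j < n \<Longrightarrow> A $$ (i, j) \<in> carrier R"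
  by (simp add: DUT_carrier_iff)

lemma DUT_zero_entry: "i < n \<Longrightarrow> j < n \<Longrightarrow> \<zero>\<^bsub>DUT n R\<^esub> $$ (i, j) = \<zero>\<^bsub>R\<^esub>"
  and DUT_add_entry: "i < n \<Longrightarrow> j < n \<Longrightarrow>
    (A \<oplus>\<^bsub>DUT n R\<^esub> B) $$ (i, j) = A $$ (i, j) \<oplus>\<^bsub>R\<^esub> B $$ (i, j)"
  and DUT_mult_entry: "i < n \<Longrightarrow> j < n \<Longrightarrow>
    (A \<otimes>\<^bsub>DUT n R\<^esub> B) $$ (i, j) = (\<Oplus>\<^bsub>R\<^esub>k\<in>{..<n}. A $$ (i, k) \<otimes>\<^bsub>R\<^esub> B $$ (k, j))"
  unfolding DUT_def by simp_all

lemma (in ring) DUT_nonzero_entry: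
  assumes A: "A \<in> carrier (DUT n R)" "A \<noteq> \<zero>\<^bsub>DUT n R\<^esub>"
  obtains i j where "i < n" "j < n" "A $$ (i, j) \<noteq> \<zero>"
proof -
  have "A = \<zero>\<^bsub>DUT n R\<^esub>" if "\<forall>i<n. \<forall>j<n. A $$ (i, j) = \<zero>"
  proof (rule eq_matI)
    have "\<zero>\<^bsub>DUT n R\<^esub> \<in> carrier_mat n n" by (simp add: DUT_def)
    then show "dim_row A = dim_row \<zero>\<^bsub>DUT n R\<^esub>" "dim_col A = dim_col \<zero>\<^bsub>DUT n R\<^esub>"
      using A by (auto simp: DUT_carrier_iff)
    fix i j assume "i < dim_row \<zero>\<^bsub>DUT n R\<^esub>" "j < dim_col \<zero>\<^bsub>DUT n R\<^esub>"
    then show "A $$ (i, j) = \<zero>\<^bsub>DUT n R\<^esub> $$ (i, j)"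
      using that by (simp add: DUT_def)
  qed
  with A that show ?thesis by blast
qed

lemma (in ring) DUT_finsum_entry:
  assumes "finite S" "f \<in> S \<rightarrow> carrier (DUT n R)" "i < n" "j < n"
  shows "finsum (DUT n R) f S $$ (i, j) = (\<Oplus>s\<in>S. f s $$ (i, j))"
proof -
  interpret D: ring "DUT n R" by (rule DUT_ring)
  have entries: "A $$ (i, j) \<in> carrier R" if "A \<in> carrier (DUT n R)" for A
    using that assms(3,4) by (rule DUT_entry_closed)
  show ?thesis
    using assms(1,2)
  proof (induction rule: finite_induct)
    case empty
    show ?case using assms(3,4) by (simp add: DUT_zero_entry)
  next
    case (insert x S)
    then have f: "f \<in> S \<rightarrow> carrier (DUT n R)" "f x \<in> carrier (DUT n R)"
      by auto
    have "finsum (DUT n R) f (insert x S) $$ (i, j) =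
        f x $$ (i, j) \<oplus> finsum (DUT n R) f S $$ (i, j)"
      unfolding D.finsum_insert[OF insert.hyps f] by (rule DUT_add_entry[OF assms(3,4)])
    also have "\<dots> = f x $$ (i, j) \<oplus> (\<Oplus>s\<in>S. f s $$ (i, j))"
      using insert.IH f by simp
    also have "\<dots> = (\<Oplus>s\<in>insert x S. f s $$ (i, j))"
      by (rule finsum_insert[symmetric]) (use insert.hyps f entries in auto)
    finally show ?case .
  qed
qed

section \<open>Polynomials over the matrix ring as matrices of polynomials\<close>

locale DUT_polynomials = UP_ring R P for R (structure) and P (structure) +
  fixes n :: nat
begin

abbreviation D where "D \<equiv> DUT n R"
abbreviation Q where "Q \<equiv> UP D"

end

sublocale DUT_polynomials \<subseteq> Q: UP_ring "DUT n R" "UP (DUT n R)"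
  using R.DUT_ring[of n] by (simp add: UP_ring_def)

context DUT_polynomials
begin

definition entry :: "(nat \<Rightarrow> 'a mat) \<Rightarrow> nat \<Rightarrow> nat \<Rightarrow> nat \<Rightarrow> 'a" where
  "entry F i j = (\<lambda>m. F m $$ (i, j))"

lemma coeff_in_DUT: "F \<in> carrier Q \<Longrightarrow> F m \<in> carrier D"
  by (simp add: UP_def mem_upD)

lemma entry_closed [simp]:
  assumes F: "F \<in> carrier Q" and ij: "i < n" "j < n"
  shows "entry F i j \<in> carrier P"
proof -
  obtain N where "bound \<zero>\<^bsub>D\<^esub> N F"
    using F by (auto simp: UP_def)
  then have "bound \<zero> N (entry F i j)"
    using ij by (auto simp: bound_def entry_def DUT_zero_entry)
  moreover have "entry F i j m \<in> carrier R" for m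
    using coeff_in_DUT[OF F, of m] ij by (auto simp: entry_def DUT_carrier_iff)
  ultimately have "entry F i j \<in> up R"
    by (intro mem_upI exI[of _ N])
  then show ?thesis
    by (simp add: P_def UP_def)
qed

lemma coeff_entry:
  assumes "F \<in> carrier Q" "i < n" "j < n"
  shows "coeff P (entry F i j) m = coeff Q F m $$ (i, j)"
proof -
  have "entry F i j \<in> up R" "F \<in> up D"
    using entry_closed[OF assms] assms(1) by (simp_all add: P_def UP_def)
  then show ?thesis
    by (simp add: P_def UP_def) (simp add: entry_def)
qed

lemma entry_below_diagonal:
  assumes "F \<in> carrier Q" "i < n" "j < i"
  shows "entry F i j = \<zero>\<^bsub>P\<^esub>"
proof -
  have "F m $$ (i, j) = \<zero>" for m
    using coeff_in_DUT[OF assms(1), of m] assms(2,3) unfolding DUT_carrier_iff by blast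
  then show ?thesis
    by (simp add: entry_def P_def UP_def)
qed

lemma entry_diagonal:
  assumes "F \<in> carrier Q" "i < n" "j < n"
  shows "entry F i i = entry F j j"
proof -
  have "F m $$ (i, i) = F m $$ (j, j)" for m
    using coeff_in_DUT[OF assms(1), of m] assms(2,3) unfolding DUT_carrier_iff by blast
  then show ?thesis
    by (simp add: entry_def)
qed

lemma entry_zero: "i < n \<Longrightarrow> j < n \<Longrightarrow> entry \<zero>\<^bsub>Q\<^esub> i j = \<zero>\<^bsub>P\<^esub>"
  by (simp add: entry_def P_def UP_def DUT_zero_entry)

lemma nonzero_entry:
  assumes F: "F \<in> carrier Q" "F \<noteq> \<zero>\<^bsub>Q\<^esub>"
  obtains i j where "i < n" "j < n" "entry F i j \<noteq> \<zero>\<^bsub>P\<^esub>"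
proof -
  obtain m where "F m \<noteq> \<zero>\<^bsub>D\<^esub>"
    using F(2) by (auto simp: UP_def)
  then obtain i j where "i < n" "j < n" "F m $$ (i, j) \<noteq> \<zero>"
    using R.DUT_nonzero_entry[OF coeff_in_DUT[OF F(1)]] by metis
  moreover from this have "entry F i j m \<noteq> \<zero>\<^bsub>P\<^esub> m"
    by (simp add: entry_def P_def UP_def)
  ultimately show ?thesis
    using that by metis
qed

lemma eq_zero_if_entries_zero:
  assumes "F \<in> carrier Q" "\<And>i j. i < n \<Longrightarrow> j < n \<Longrightarrow> entry F i j = \<zero>\<^bsub>P\<^esub>"
  shows "F = \<zero>\<^bsub>Q\<^esub>"
proof (rule ccontr)
  assume "F \<noteq> \<zero>\<^bsub>Q\<^esub>"
  with assms(1) obtain i j where "i < n" "j < n" "entry F i j \<noteq> \<zero>\<^bsub>P\<^esub>"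
    by (rule nonzero_entry)
  with assms(2) show False by blast
qed

text \<open>
  The coefficient of \<open>x\<^sup>m\<close> on either side is the sum of \<open>(F\<^sub>s)\<^sub>i\<^sub>k (G\<^sub>t)\<^sub>k\<^sub>j\<close> over
  \<open>s + t = m\<close> and \<open>k < n\<close>; the two sides differ in the order of summation.
\<close>
lemma entry_mult:
  assumes F: "F \<in> carrier Q" and G: "G \<in> carrier Q" and ij: "i < n" "j < n"
  shows "entry (F \<otimes>\<^bsub>Q\<^esub> G) i j = (\<Oplus>\<^bsub>P\<^esub>k\<in>{..<n}. entry F i k \<otimes>\<^bsub>P\<^esub> entry G k j)"
proof (rule up_eqI)
  fix m
  let ?f = "\<lambda>s k. coeff Q F s $$ (i, k)" and ?g = "\<lambda>t k. coeff Q G t $$ (k, j)"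
  have c: "?f s k \<in> carrier R" "?g s k \<in> carrier R" if "k < n" for s k
    by (rule DUT_entry_closed[OF Q.coeff_closed[OF F] ij(1) that],
        rule DUT_entry_closed[OF Q.coeff_closed[OF G] that ij(2)])
  have "coeff P (entry (F \<otimes>\<^bsub>Q\<^esub> G) i j) m =
      (\<Oplus>\<^bsub>D\<^esub>s\<in>{..m}. coeff Q F s \<otimes>\<^bsub>D\<^esub> coeff Q G (m - s)) $$ (i, j)"
    using F G ij by (simp add: coeff_entry)
  also have "\<dots> = (\<Oplus>s\<in>{..m}. (coeff Q F s \<otimes>\<^bsub>D\<^esub> coeff Q G (m - s)) $$ (i, j))"
    by (rule R.DUT_finsum_entry) (use F G ij in auto)
  also have "\<dots> = (\<Oplus>s\<in>{..m}. \<Oplus>k\<in>{..<n}. ?f s k \<otimes> ?g (m - s) k)"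
    using ij by (simp add: DUT_mult_entry)
  also have "\<dots> = (\<Oplus>k\<in>{..<n}. \<Oplus>s\<in>{..m}. ?f s k \<otimes> ?g (m - s) k)"
    by (rule R.finsum_finsum_swap) (use c in auto)
  also have "\<dots> = (\<Oplus>k\<in>{..<n}. coeff P (entry F i k \<otimes>\<^bsub>P\<^esub> entry G k j) m)"
    by (rule R.finsum_cong') (use F G ij c in \<open>auto simp: coeff_entry intro!: R.finsum_closed\<close>)
  also have "\<dots> = coeff P (\<Oplus>\<^bsub>P\<^esub>k\<in>{..<n}. entry F i k \<otimes>\<^bsub>P\<^esub> entry G k j) m"
    by (rule coeff_finsum[symmetric]) (use F G ij in auto)
  finally show "coeff P (entry (F \<otimes>\<^bsub>Q\<^esub> G) i j) m = \<dots>" .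
next
  show "entry (F \<otimes>\<^bsub>Q\<^esub> G) i j \<in> carrier P"
    by (rule entry_closed[OF Q.UP_mult_closed[OF F G] ij])
  show "(\<Oplus>\<^bsub>P\<^esub>k\<in>{..<n}. entry F i k \<otimes>\<^bsub>P\<^esub> entry G k j) \<in> carrier P"
    by (rule P.finsum_closed) (use F G ij in simp)
qed

lemma entry_monom:
  assumes "A \<in> carrier D" "i < n" "j < n"
  shows "entry (monom Q A 0) i j = monom P (A $$ (i, j)) 0"
proof (rule up_eqI)
  have M: "monom Q A 0 \<in> carrier Q"
    using assms(1) by (rule Q.monom_closed)
  have c: "A $$ (i, j) \<in> carrier R"
    using assms by (rule DUT_entry_closed)
  show "entry (monom Q A 0) i j \<in> carrier P"
    using M assms(2,3) by (rule entry_closed)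
  show "monom P (A $$ (i, j)) 0 \<in> carrier P"
    using c by (rule monom_closed)
  show "coeff P (entry (monom Q A 0) i j) m = coeff P (monom P (A $$ (i, j)) 0) m" for m
    unfolding coeff_entry[OF M assms(2,3)] Q.coeff_monom[OF assms(1)] coeff_monom[OF c]
    using assms(2,3) by (simp add: DUT_zero_entry)
qed

section \<open>Products in which only one term survives\<close>

lemma entry_mult_single_term:
  assumes "F \<in> carrier Q" "G \<in> carrier Q" "i < n" "j < n" "k < n"
    and "\<And>l. l < n \<Longrightarrow> l \<noteq> k \<Longrightarrow> entry F i l = \<zero>\<^bsub>P\<^esub> \<or> entry G l j = \<zero>\<^bsub>P\<^esub>"
  shows "entry (F \<otimes>\<^bsub>Q\<^esub> G) i j = entry F i k \<otimes>\<^bsub>P\<^esub> entry G k j"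
  unfolding entry_mult[OF assms(1-4)]
proof (rule P.finsum_eq_single_term)
  fix l assume "l \<in> {..<n}" "l \<noteq> k"
  then show "entry F i l \<otimes>\<^bsub>P\<^esub> entry G l j = \<zero>\<^bsub>P\<^esub>"
    using assms(1-5) assms(6)[of l] by auto
next
  show "entry F i k \<otimes>\<^bsub>P\<^esub> entry G k j \<in> carrier P"
    by (intro UP_mult_closed entry_closed assms)
  show "finite {..<n}" "k \<in> {..<n}"
    using assms(5) by simp_all
qed

text \<open>
  Left multiplication by the triangular \<open>F\<close> adds to row \<open>i\<close> of \<open>G\<close> only multiples of later rows,
  which vanish; right multiplication adds to column \<open>j\<close> only multiples of earlier columns, which
  vanish in row \<open>i\<close>.
\<close>
lemma entry_sandwich_extremal:
  assumes F: "F \<in> carrier Q" and G: "G \<in> carrier Q" and ij: "i < n" "j < n"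
    and rows: "\<And>k l. i < k \<Longrightarrow> k < n \<Longrightarrow> l < n \<Longrightarrow> entry G k l = \<zero>\<^bsub>P\<^esub>"
    and cols: "\<And>l. l < j \<Longrightarrow> entry G i l = \<zero>\<^bsub>P\<^esub>"
  shows "entry (F \<otimes>\<^bsub>Q\<^esub> G \<otimes>\<^bsub>Q\<^esub> F) i j = entry F i i \<otimes>\<^bsub>P\<^esub> entry G i j \<otimes>\<^bsub>P\<^esub> entry F j j"
proof -
  have FG: "entry (F \<otimes>\<^bsub>Q\<^esub> G) i l = entry F i i \<otimes>\<^bsub>P\<^esub> entry G i l" if "l < n" for l
  proof (rule entry_mult_single_term[OF F G ij(1) that ij(1)])
    show "entry F i k = \<zero>\<^bsub>P\<^esub> \<or> entry G k l = \<zero>\<^bsub>P\<^esub>" if "k < n" "k \<noteq> i" for k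
    proof (cases "k < i")
      case True
      then show ?thesis using entry_below_diagonal[OF F ij(1)] by blast
    next
      case False
      then show ?thesis using rows[of k l] that \<open>l < n\<close> by simp
    qed
  qed
  have "entry (F \<otimes>\<^bsub>Q\<^esub> G \<otimes>\<^bsub>Q\<^esub> F) i j = entry (F \<otimes>\<^bsub>Q\<^esub> G) i j \<otimes>\<^bsub>P\<^esub> entry F j j"
  proof (rule entry_mult_single_term[OF _ F ij ij(2)])
    show "entry (F \<otimes>\<^bsub>Q\<^esub> G) i l = \<zero>\<^bsub>P\<^esub> \<or> entry F l j = \<zero>\<^bsub>P\<^esub>" if "l < n" "l \<noteq> j" for l
    proof (cases "l < j")
      case True
      then show ?thesis using FG[OF that(1)] cols F ij by simp
    next
      case False
      then show ?thesis using entry_below_diagonal[OF F that(1), of j] that by simp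
    qed
  qed (use F G in simp)
  then show ?thesis using FG[OF ij(2)] by simp
qed

text \<open>
  Only the first column and the last row of \<open>F\<close> enter. As \<open>F\<close> is triangular, these vanish off
  the diagonal, which is why a corner matrix sees \<open>F\<close> as if it were scalar.
\<close>
lemma entry_sandwich_corner:
  assumes F: "F \<in> carrier Q" and G: "G \<in> carrier Q" and ij: "i < n" "j < n"
    and corner: "\<And>k l. k < n \<Longrightarrow> l < n \<Longrightarrow> (k, l) \<noteq> (0, n - 1) \<Longrightarrow> entry G k l = \<zero>\<^bsub>P\<^esub>"
  shows "entry (F \<otimes>\<^bsub>Q\<^esub> G \<otimes>\<^bsub>Q\<^esub> F) i j =
    entry F i 0 \<otimes>\<^bsub>P\<^esub> entry G 0 (n - 1) \<otimes>\<^bsub>P\<^esub> entry F (n - 1) j"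
proof -
  have n: "0 < n" "n - 1 < n" using ij by auto
  have FG: "entry (F \<otimes>\<^bsub>Q\<^esub> G) i l = entry F i 0 \<otimes>\<^bsub>P\<^esub> entry G 0 l" if "l < n" for l
  proof (rule entry_mult_single_term[OF F G ij(1) that n(1)])
    show "entry F i k = \<zero>\<^bsub>P\<^esub> \<or> entry G k l = \<zero>\<^bsub>P\<^esub>" if "k < n" "k \<noteq> 0" for k
      using corner[of k l] that \<open>l < n\<close> by simp
  qed
  have "entry (F \<otimes>\<^bsub>Q\<^esub> G \<otimes>\<^bsub>Q\<^esub> F) i j = entry (F \<otimes>\<^bsub>Q\<^esub> G) i (n - 1) \<otimes>\<^bsub>P\<^esub> entry F (n - 1) j"
  proof (rule entry_mult_single_term[OF _ F ij n(2)])
    show "entry (F \<otimes>\<^bsub>Q\<^esub> G) i l = \<zero>\<^bsub>P\<^esub> \<or> entry F l j = \<zero>\<^bsub>P\<^esub>"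
      if "l < n" "l \<noteq> n - 1" for l
      using FG[OF that(1)] corner[of 0 l] that F ij n by simp
  qed (use F G in simp)
  then show ?thesis using FG[OF n(2)] by simp
qed

lemma entry_sandwich_scalar:
  assumes F: "F \<in> carrier Q" and G: "G \<in> carrier Q" and ij: "i < n" "j < n"
    and scalar: "\<And>k l. k < n \<Longrightarrow> l < n \<Longrightarrow> k \<noteq> l \<Longrightarrow> entry F k l = \<zero>\<^bsub>P\<^esub>"
  shows "entry (F \<otimes>\<^bsub>Q\<^esub> G \<otimes>\<^bsub>Q\<^esub> F) i j = entry F i i \<otimes>\<^bsub>P\<^esub> entry G i j \<otimes>\<^bsub>P\<^esub> entry F j j"
proof -
  have FG: "entry (F \<otimes>\<^bsub>Q\<^esub> G) i j = entry F i i \<otimes>\<^bsub>P\<^esub> entry G i j"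
    by (rule entry_mult_single_term[OF F G ij ij(1)]) (use scalar[OF ij(1)] in blast)
  have "entry (F \<otimes>\<^bsub>Q\<^esub> G \<otimes>\<^bsub>Q\<^esub> F) i j = entry (F \<otimes>\<^bsub>Q\<^esub> G) i j \<otimes>\<^bsub>P\<^esub> entry F j j"
    by (rule entry_mult_single_term[OF _ F ij ij(2)]) (use F G scalar[OF _ ij(2)] in auto)
  then show ?thesis using FG by simp
qed

section \<open>The inner McCoy property in both directions\<close>

lemma inner_McCoy_DUT:
  assumes mccoy: "inner_McCoy R" and n: "2 \<le> n"
  shows "inner_McCoy D"
  unfolding inner_McCoy_def
proof (intro ballI impI)
  fix F G assume "F \<in> carrier Q - {\<zero>\<^bsub>Q\<^esub>}" "G \<in> carrier Q - {\<zero>\<^bsub>Q\<^esub>}"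
    and FGF: "F \<otimes>\<^bsub>Q\<^esub> G \<otimes>\<^bsub>Q\<^esub> F = \<zero>\<^bsub>Q\<^esub>"
  then have F: "F \<in> carrier Q" "F \<noteq> \<zero>\<^bsub>Q\<^esub>" and G: "G \<in> carrier Q" "G \<noteq> \<zero>\<^bsub>Q\<^esub>" by auto
  define f where "f = entry F 0 0"
  have f: "f \<in> carrier P" using F n by (simp add: f_def)
  have diag: "entry F i i = f" if "i < n" for i
    using entry_diagonal[OF F(1) that, of 0] n by (simp add: f_def)

  (* The last nonzero row of G, and the first nonzero entry in it. *)
  obtain i j where ij: "i < n" "j < n" "entry G i j \<noteq> \<zero>\<^bsub>P\<^esub>"
    and rows: "\<And>k l. i < k \<Longrightarrow> k < n \<Longrightarrow> l < n \<Longrightarrow> entry G k l = \<zero>\<^bsub>P\<^esub>"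
    and cols: "\<And>l. l < j \<Longrightarrow> entry G i l = \<zero>\<^bsub>P\<^esub>"
  proof -
    let ?row = "\<lambda>k. k < n \<and> (\<exists>l<n. entry G k l \<noteq> \<zero>\<^bsub>P\<^esub>)"
    define i where "i = (GREATEST k. ?row k)"
    obtain k where k: "?row k"
      using nonzero_entry[OF G] by metis
    then have i: "?row i"
      unfolding i_def by (rule GreatestI_nat[where b = n]) simp
    have rows: "entry G k l = \<zero>\<^bsub>P\<^esub>" if "i < k" "k < n" "l < n" for k l
    proof (rule ccontr)
      assume "entry G k l \<noteq> \<zero>\<^bsub>P\<^esub>"
      with that have "?row k" by blast
      then have "k \<le> i"
        unfolding i_def by (rule Greatest_le_nat[where b = n]) simp
      with that show False by simp
    qed
    let ?col = "\<lambda>l. l < n \<and> entry G i l \<noteq> \<zero>\<^bsub>P\<^esub>"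
    define j where "j = (LEAST l. ?col l)"
    have j: "?col j"
    proof -
      from i obtain l where "?col l" by blast
      then show ?thesis unfolding j_def by (rule LeastI)
    qed
    have cols: "entry G i l = \<zero>\<^bsub>P\<^esub>" if "l < j" for l
    proof (rule ccontr)
      assume "entry G i l \<noteq> \<zero>\<^bsub>P\<^esub>"
      with that j have "?col l" by simp
      then have "j \<le> l"
        unfolding j_def by (rule Least_le)
      with that show False by simp
    qed
    from i j have "i < n" "j < n" "entry G i j \<noteq> \<zero>\<^bsub>P\<^esub>" by simp_all
    then show ?thesis using rows cols by (rule that)
  qed
  define g where "g = entry G i j"
  have g: "g \<in> carrier P" "g \<noteq> \<zero>\<^bsub>P\<^esub>"
    using entry_closed[OF G(1) ij(1,2)] ij(3) by (simp_all add: g_def)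
  have fgf: "f \<otimes>\<^bsub>P\<^esub> g \<otimes>\<^bsub>P\<^esub> f = \<zero>\<^bsub>P\<^esub>"
    using entry_sandwich_extremal[OF F(1) G(1) ij(1,2) rows cols]
    by (simp add: FGF entry_zero[OF ij(1,2)] diag[OF ij(1)] diag[OF ij(2)] g_def)
  obtain r where r: "r \<in> carrier R" "r \<noteq> \<zero>"
    and frf: "f \<otimes>\<^bsub>P\<^esub> monom P r 0 \<otimes>\<^bsub>P\<^esub> f = \<zero>\<^bsub>P\<^esub>"
  proof (cases "f = \<zero>\<^bsub>P\<^esub>")
    case True
    \<comment> \<open>Any nonzero element of \<open>R\<close> will do; a coefficient of \<open>g\<close> is at hand.\<close>
    obtain m where m: "coeff P g m \<noteq> \<zero>"
    proof (rule ccontr)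
      assume "\<not> thesis"
      with that have "coeff P g m = coeff P \<zero>\<^bsub>P\<^esub> m" for m by auto
      then have "g = \<zero>\<^bsub>P\<^esub>" using g(1) UP_zero_closed by (rule up_eqI)
      with g(2) show False by contradiction
    qed
    have "coeff P g m \<in> carrier R" using g(1) by (rule coeff_closed)
    moreover from this have "f \<otimes>\<^bsub>P\<^esub> monom P (coeff P g m) 0 \<otimes>\<^bsub>P\<^esub> f = \<zero>\<^bsub>P\<^esub>"
      using True by simp
    ultimately show ?thesis using m that by blast
  next
    case False
    then have "\<exists>r \<in> carrier R - {\<zero>}. f \<otimes>\<^bsub>P\<^esub> monom P r 0 \<otimes>\<^bsub>P\<^esub> f = \<zero>\<^bsub>P\<^esub>"
      using mccoy f g fgf unfolding inner_McCoy_def P_def[symmetric] by blast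
    with that show ?thesis by blast
  qed

  \<comment> \<open>As \<open>n \<ge> 2\<close>, the corner is off the diagonal, so the matrix has a constant (zero) diagonal.\<close>
  define C where "C = mat n n (\<lambda>(i, j). if i = 0 \<and> j = n - 1 then r else \<zero>)"
  have C: "C \<in> carrier D"
    using n r by (auto simp: C_def DUT_carrier_iff)
  have "C $$ (0, n - 1) = r" using n by (simp add: C_def)
  then have "C \<noteq> \<zero>\<^bsub>D\<^esub>"
    using n r DUT_zero_entry[of 0 n "n - 1" R] by auto
  moreover have "F \<otimes>\<^bsub>Q\<^esub> monom Q C 0 \<otimes>\<^bsub>Q\<^esub> F = \<zero>\<^bsub>Q\<^esub>"
  proof (rule eq_zero_if_entries_zero)
    fix i j assume ij: "i < n" "j < n"
    have M: "entry (monom Q C 0) k l = (if (k, l) = (0, n - 1) then monom P r 0 else \<zero>\<^bsub>P\<^esub>)"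
      if "k < n" "l < n" for k l
      using that C by (simp add: entry_monom) (simp add: C_def)
    have "entry (F \<otimes>\<^bsub>Q\<^esub> monom Q C 0 \<otimes>\<^bsub>Q\<^esub> F) i j =
        entry F i 0 \<otimes>\<^bsub>P\<^esub> entry (monom Q C 0) 0 (n - 1) \<otimes>\<^bsub>P\<^esub> entry F (n - 1) j"
      by (rule entry_sandwich_corner) (use F C ij M in auto)
    also have "\<dots> = entry F i 0 \<otimes>\<^bsub>P\<^esub> monom P r 0 \<otimes>\<^bsub>P\<^esub> entry F (n - 1) j"
      using n by (simp add: M)
    also have "\<dots> = \<zero>\<^bsub>P\<^esub>"
    proof (cases "i = 0 \<and> j = n - 1")
      case True
      then show ?thesis using frf n by (simp add: diag)
    next
      case False
      then have "entry F i 0 = \<zero>\<^bsub>P\<^esub> \<or> entry F (n - 1) j = \<zero>\<^bsub>P\<^esub>"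
        using entry_below_diagonal[OF F(1), of i 0] entry_below_diagonal[OF F(1), of "n - 1" j] ij
        by linarith
      then show ?thesis using F ij n r by auto
    qed
    finally show "entry (F \<otimes>\<^bsub>Q\<^esub> monom Q C 0 \<otimes>\<^bsub>Q\<^esub> F) i j = \<zero>\<^bsub>P\<^esub>" .
  qed (use F C in simp)
  ultimately show "\<exists>C \<in> carrier D - {\<zero>\<^bsub>D\<^esub>}. F \<otimes>\<^bsub>Q\<^esub> monom Q C 0 \<otimes>\<^bsub>Q\<^esub> F = \<zero>\<^bsub>Q\<^esub>"
    using C by blast
qed

lemma obtain_scalar_polynomial:
  assumes f: "f \<in> carrier P"
  obtains F where "F \<in> carrier Q"
    "\<And>i j. i < n \<Longrightarrow> j < n \<Longrightarrow> entry F i j = (if i = j then f else \<zero>\<^bsub>P\<^esub>)"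
proof -
  define F where "F = (\<lambda>m. mat n n (\<lambda>(i, j). if i = j then f m else \<zero>))"
  have fm: "f m \<in> carrier R" for m using f by (auto simp: P_def UP_def)
  obtain N where N: "bound \<zero> N f" using f by (auto simp: P_def UP_def)
  have "bound \<zero>\<^bsub>D\<^esub> N F"
    using N by (auto simp: bound_def F_def DUT_def intro!: eq_matI)
  moreover have "F m \<in> carrier D" for m
    using fm by (auto simp: F_def DUT_carrier_iff)
  ultimately have "F \<in> up D" by (intro mem_upI exI[of _ N])
  then have "F \<in> carrier Q" by (simp add: UP_def)
  moreover have "entry F i j = (if i = j then f else \<zero>\<^bsub>P\<^esub>)" if "i < n" "j < n" for i j
    using that by (auto simp: F_def entry_def P_def UP_def)
  ultimately show ?thesis by (rule that)
qed

lemma inner_McCoy_of_DUT: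
  assumes mccoy: "inner_McCoy D" and n: "0 < n"
  shows "inner_McCoy R"
  unfolding inner_McCoy_def P_def[symmetric]
proof (intro ballI impI)
  fix f g assume "f \<in> carrier P - {\<zero>\<^bsub>P\<^esub>}" "g \<in> carrier P - {\<zero>\<^bsub>P\<^esub>}"
    and fgf: "f \<otimes>\<^bsub>P\<^esub> g \<otimes>\<^bsub>P\<^esub> f = \<zero>\<^bsub>P\<^esub>"
  then have f: "f \<in> carrier P" "f \<noteq> \<zero>\<^bsub>P\<^esub>" and g: "g \<in> carrier P" "g \<noteq> \<zero>\<^bsub>P\<^esub>" by auto
  obtain F where F: "F \<in> carrier Q"
    and Fe: "\<And>i j. i < n \<Longrightarrow> j < n \<Longrightarrow> entry F i j = (if i = j then f else \<zero>\<^bsub>P\<^esub>)"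
    using obtain_scalar_polynomial[OF f(1)] by metis
  obtain G where G: "G \<in> carrier Q"
    and Ge: "\<And>i j. i < n \<Longrightarrow> j < n \<Longrightarrow> entry G i j = (if i = j then g else \<zero>\<^bsub>P\<^esub>)"
    using obtain_scalar_polynomial[OF g(1)] by metis
  have sandwich: "entry (F \<otimes>\<^bsub>Q\<^esub> H \<otimes>\<^bsub>Q\<^esub> F) i j = f \<otimes>\<^bsub>P\<^esub> entry H i j \<otimes>\<^bsub>P\<^esub> f"
    if "H \<in> carrier Q" "i < n" "j < n" for H i j
    using entry_sandwich_scalar[OF F that] that by (simp add: Fe)
  have "F \<noteq> \<zero>\<^bsub>Q\<^esub>" "G \<noteq> \<zero>\<^bsub>Q\<^esub>"
    using Fe[OF n n] Ge[OF n n] f g entry_zero[OF n n] by auto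
  moreover have "F \<otimes>\<^bsub>Q\<^esub> G \<otimes>\<^bsub>Q\<^esub> F = \<zero>\<^bsub>Q\<^esub>"
    by (rule eq_zero_if_entries_zero) (use F G f g fgf in \<open>auto simp: sandwich Ge\<close>)
  ultimately obtain C where C: "C \<in> carrier D" "C \<noteq> \<zero>\<^bsub>D\<^esub>"
    and FCF: "F \<otimes>\<^bsub>Q\<^esub> monom Q C 0 \<otimes>\<^bsub>Q\<^esub> F = \<zero>\<^bsub>Q\<^esub>"
    using mccoy F G unfolding inner_McCoy_def by blast
  obtain i j where ij: "i < n" "j < n" "C $$ (i, j) \<noteq> \<zero>"
    using R.DUT_nonzero_entry[OF C] .
  have "f \<otimes>\<^bsub>P\<^esub> monom P (C $$ (i, j)) 0 \<otimes>\<^bsub>P\<^esub> f = \<zero>\<^bsub>P\<^esub>"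
    using sandwich[OF Q.monom_closed[OF C(1), of 0] ij(1,2)]
    unfolding FCF entry_zero[OF ij(1,2)] entry_monom[OF C(1) ij(1,2)] by (rule sym)
  moreover have "C $$ (i, j) \<in> carrier R"
    using C ij by (simp add: DUT_carrier_iff)
  ultimately show "\<exists>r \<in> carrier R - {\<zero>}. f \<otimes>\<^bsub>P\<^esub> monom P r 0 \<otimes>\<^bsub>P\<^esub> f = \<zero>\<^bsub>P\<^esub>"
    using ij by blast
qed

end

theorem theorem3p3:
  fixes R :: "('a, 'm) ring_scheme" and n :: nat
  assumes "ring R"
    and "n \<ge> 2"
  shows "inner_McCoy R \<longleftrightarrow> inner_McCoy (DUT n R)"
proof -
  interpret DUT_polynomials R "UP R" n
    using assms(1) by (simp add: DUT_polynomials_def UP_ring_def)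
  show ?thesis
    using inner_McCoy_DUT inner_McCoy_of_DUT assms(2) by auto
qed

end
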